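(* For every $s\subseteq N$ let $M_s$ be a constant with $M_s\ge\max\{V(s),0\}$, and assume $V(\{i\})\ge 0$ for all $i\in N$. Let $$\mathcal F^{\mathrm{stab}}=\Bigl\{(v,x,y,z,\pi)\in\mathcal F:\ \sum_{i\in s}v_i\ \ge\ V(s)-M_s\Bigl(|s|-\sum_{i\in s}z_{ig}\Bigr)\ \text{ for all } g\in G \text{ and all } s\subseteq N\Bigr\}.$$ Then the mixed-integer system $(v,x,y,z,\pi)\in\mathcal F^{\mathrm{stab}}$ is an exact extended formulation for SCS payoffs: $$\operatorname{proj}_v(\mathcal F^{\mathrm{stab}})=\mathcal S .$$ In particular, maximizing $\sum_{i\in N}v_i$ over $\mathcal F^{\mathrm{stab}}$ yields an optimal stable coalition structure (OSCS).
   Context: **Game.** $N=\{1,\dots,n\}$ is a finite player set, $R$ a finite item set, $I_j\subseteq N$ the set of players for whom item $j$ is available, $R_i=\{j\in R:i\in I_j\}$. Data: profits $p^i_j\ge0$, weights $a_j>0$, budgets $b^i$, capacities $u^i_j\ge 0$, private constraints $B^ix^i\le d^i$, and a pooling parameter $\alpha\in(0,1]$. For a coalition $c\subseteq N$ let $I^c_j=I_j\cap c$, $R^c=\{j:I^c_j\ne\emptyset\}$, $R^c_{\mathrm{ind}}=\{j\in R^c:|I^c_j|=1\}$, $R^c_{\mathrm{com}}=\{j\in R^c:|I^c_j|\ge2\}$. With variables $x^i=(x^i_j)_{j\in R_i}$ for $i\in c$ and $y^c_j$ for $j\in R^c_{\mathrm{com}}$, $V(c)$ is the maximum of $\sum_{j\in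 R^c}\sum_{i\in I^c_j}p^i_jx^i_j$ subject to: $\sum_{j\in R^c_{\mathrm{com}}}a_jy^c_j+\sum_{j\in R^c_{\mathrm{ind}}}\sum_{i\in I^c_j}a_jx^i_j\le\sum_{i\in c}b^i$; $y^c_j=\sum_{i\in I^c_j}x^i_j$ for $j\in R^c_{\mathrm{com}}$; $B^ix^i\le d^i$ for $i\in c$; $0\le x^i_j\le u^i_j$; $0\le y^c_j\le\alpha\sum_{i\in I^c_j}u^i_j$ and $y^c_j\in\mathbb Z_+$ for $j\in R^c_{\mathrm{com}}$; $x^i_j\in\mathbb Z_+$ for $j\in R^c_{\mathrm{ind}}$ (the $x^i_j$ with $j\in R^c_{\mathrm{com}}$ are continuous). $V(\emptyset)=0$. Standing assumptions: every such program is feasible and bounded, the zero plan is feasible for every program, and the private constraints do not tie a member's common items to its other decisions. **Stability.** A coalition structure is a partition $CS(N)$ of $N$. The Core of the game restricted to $c$ is the set of $(w_i)_{i\in c}$ with $\sum_{i\in c}w_i=V(c)$ and $\sum_{i\in s}w_i\ge V(s)$ for all $s\subseteq c$. A pair $(CS(N),v)$, $v\in\mathbb R^N$, is a stable coalition structure (SCS) if for every $c\in CS(N)$ the restriction of $v$ to $c$ lies in the Core of the game restricted to $c$. $\mathcal S\subseteq\mathbb R^N$ is the set of $v$ for which some partition $CS(N)$ makes $(CS(N),v)$ an SCS. An OSCS is an SCS maximizing $\sum_{i\in N}v_i$ among all SCSs. **The set $\mathcal F$.** Let $G:=N$ index groups. $\mathcal F$ is the set of mixed-integer points with variables $v_i$,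 $z_{ig}$, $x^{i,g}_j$ ($j\in R$, $i\in I_j$), $y^g_j$, $\pi_g$, and auxiliary variables $\phi_{ig}$ (and $w^g_j$ if $\alpha<1$; the auxiliary variables are suppressed when writing points as $(v,x,y,z,\pi)$) satisfying, for all $i\in N$, $g\in G$, $j\in R$: (1) $\sum_{g\in G}z_{ig}=1$; (2) $\pi_g=\sum_{j\in R}\sum_{i\in I_j}p^i_jx^{i,g}_j=\sum_{i\in N}\phi_{ig}$; (3) $\phi_{ig}\le v_i$, $\phi_{ig}\le Mz_{ig}$, $\phi_{ig}\ge v_i-M(1-z_{ig})$, $\phi_{ig}\ge0$, where $M=\sum_{i\in N}\sum_{j\in R_i}p^i_ju^i_j$ (so that $\phi_{ig}=v_iz_{ig}$); (4) $\sum_{j\in R}a_jy^g_j\le\sum_{i\in N}b^iz_{ig}$; (5) $y^g_j=\sum_{i\in I_j}x^{i,g}_j$; (6) $B^ix^{i,g}\le d^iz_{ig}$; (7) $0\le x^{i,g}_j\le u^i_jz_{ig}$ for $i\in I_j$; (8) $y^g_j\le\sum_{i\in I_j}u^i_jz_{ig}$; (9) $z_{ig}=0$ whenever $i<g$; (10) $\sum_{i\in N}z_{ig}\le|N|z_{gg}$; (11) $v_i\ge0$, $\pi_g\ge 0$, $y^g_j\in\mathbb Z_+$, $z_{ig}\in\{0,1\}$; (12) only if $\alpha<1$: $w^g_j\in\{0,1\}$, $2w^g_j\le\sum_{i\in I_j}z_{ig}\le(|I_j|-1)w^g_j+1$, and $y^g_j\le\alpha\sum_{i\in I_j}u^i_jz_{ig}+M_j(1-w^g_j)$,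 where $M_j\ge(1-\alpha)\max_{i\in I_j}u^i_j$. *)

theory Defs
  imports "HOL-Analysis.Analysis"
begin

text \<open>
  Vectors and matrices are total functions of which only the entries at admissible indices are ever
  inspected. The private constraint matrix of player \<open>i\<close> has rows \<open>k < num_private i\<close> and columns
  \<open>items_of i\<close>.
\<close>

record 'r game =
  num_players :: nat
  items :: "'r set"
  avail :: "'r \<Rightarrow> nat set"
  profit :: "nat \<Rightarrow> 'r \<Rightarrow> real"
  weight :: "'r \<Rightarrow> real"
  budget :: "nat \<Rightarrow> real"
  cap :: "nat \<Rightarrow> 'r \<Rightarrow> real"
  num_private :: "nat \<Rightarrow> nat"
  private_mat :: "nat \<Rightarrow> nat \<Rightarrow> 'r \<Rightarrow> real"
  private_rhs :: "nat \<Rightarrow> nat \<Rightarrow> real"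
  pooling :: real

definition players :: "('r, 'm) game_scheme \<Rightarrow> nat set" where
  "players \<Gamma> = {1..num_players \<Gamma>}"

definition items_of :: "('r, 'm) game_scheme \<Rightarrow> nat \<Rightarrow> 'r set" where
  "items_of \<Gamma> i = {j \<in> items \<Gamma>. i \<in> avail \<Gamma> j}"

definition coal_avail :: "('r, 'm) game_scheme \<Rightarrow> nat set \<Rightarrow> 'r \<Rightarrow> nat set" where
  "coal_avail \<Gamma> c j = avail \<Gamma> j \<inter> c"

definition coal_items :: "('r, 'm) game_scheme \<Rightarrow> nat set \<Rightarrow> 'r set" where
  "coal_items \<Gamma> c = {j \<in> items \<Gamma>. coal_avail \<Gamma> c j \<noteq> {}}"

definition ind_items :: "('r, 'm) game_scheme \<Rightarrow> nat set \<Rightarrow> 'r set" where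
  "ind_items \<Gamma> c = {j \<in> coal_items \<Gamma> c. card (coal_avail \<Gamma> c j) = 1}"

definition com_items :: "('r, 'm) game_scheme \<Rightarrow> nat set \<Rightarrow> 'r set" where
  "com_items \<Gamma> c = {j \<in> coal_items \<Gamma> c. card (coal_avail \<Gamma> c j) \<ge> 2}"

definition private_lhs ::
    "('r, 'm) game_scheme \<Rightarrow> nat \<Rightarrow> nat \<Rightarrow> ('r \<Rightarrow> real) \<Rightarrow> real" where
  "private_lhs \<Gamma> i k xi = (\<Sum>j\<in>items_of \<Gamma> i. private_mat \<Gamma> i k j * xi j)"

definition private_ok :: "('r, 'm) game_scheme \<Rightarrow> nat \<Rightarrow> ('r \<Rightarrow> real) \<Rightarrow> bool" where
  "private_ok \<Gamma> i xi \<longleftrightarrow> (\<forall>k<num_private \<Gamma> i. private_lhs \<Gamma> i k xi \<le> private_rhs \<Gamma> i k)"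

definition box_ok :: "('r, 'm) game_scheme \<Rightarrow> nat \<Rightarrow> ('r \<Rightarrow> real) \<Rightarrow> bool" where
  "box_ok \<Gamma> i xi \<longleftrightarrow> (\<forall>j\<in>items_of \<Gamma> i. 0 \<le> xi j \<and> xi j \<le> cap \<Gamma> i j)"

definition feasible ::
    "('r, 'm) game_scheme \<Rightarrow> nat set \<Rightarrow> (nat \<Rightarrow> 'r \<Rightarrow> real) \<Rightarrow> ('r \<Rightarrow> real) \<Rightarrow> bool" where
  "feasible \<Gamma> c x y \<longleftrightarrow>
     (\<Sum>j\<in>com_items \<Gamma> c. weight \<Gamma> j * y j)
       + (\<Sum>j\<in>ind_items \<Gamma> c. \<Sum>i\<in>coal_avail \<Gamma> c j. weight \<Gamma> j * x i j)
       \<le> (\<Sum>i\<in>c. budget \<Gamma> i) \<and>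
     (\<forall>j\<in>com_items \<Gamma> c. y j = (\<Sum>i\<in>coal_avail \<Gamma> c j. x i j)) \<and>
     (\<forall>i\<in>c. private_ok \<Gamma> i (x i)) \<and>
     (\<forall>i\<in>c. box_ok \<Gamma> i (x i)) \<and>
     (\<forall>j\<in>com_items \<Gamma> c.
        0 \<le> y j \<and> y j \<le> pooling \<Gamma> * (\<Sum>i\<in>coal_avail \<Gamma> c j. cap \<Gamma> i j) \<and> y j \<in> \<nat>) \<and>
     (\<forall>j\<in>ind_items \<Gamma> c. \<forall>i\<in>coal_avail \<Gamma> c j. x i j \<in> \<nat>)"

definition objective ::
    "('r, 'm) game_scheme \<Rightarrow> nat set \<Rightarrow> (nat \<Rightarrow> 'r \<Rightarrow> real) \<Rightarrow> real" where
  "objective \<Gamma> c x = (\<Sum>j\<in>coal_items \<Gamma> c. \<Sum>i\<in>coal_avail \<Gamma> c j. profit \<Gamma> i j * x i j)"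

text \<open>
  The maximum exists under \<open>wf_game\<close> below: the plans are confined to a compact box and the
  aggregate amounts to finitely many integers.
\<close>

definition coal_value :: "('r, 'm) game_scheme \<Rightarrow> nat set \<Rightarrow> real" where
  "coal_value \<Gamma> c =
     (if c = {} then 0
      else (GREATEST r. \<exists>x y. feasible \<Gamma> c x y \<and> r = objective \<Gamma> c x))"

text \<open>
  Private constraints do not tie a member's common items to its other decisions: the set of
  admissible individual plans is a product, i.e. the common part of one plan can be combined
  with the remaining part of another one.
\<close>

definition untied :: "('r, 'm) game_scheme \<Rightarrow> bool" where
  "untied \<Gamma> \<longleftrightarrow>
     (\<forall>c\<subseteq>players \<Gamma>. \<forall>i\<in>c. \<forall>xi xi'.
        private_ok \<Gamma> i xi \<and> box_ok \<Gamma> i xi \<and> private_ok \<Gamma> i xi' \<and> box_ok \<Gamma> i xi' \<longrightarrow>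
        private_ok \<Gamma> i (\<lambda>j. if j \<in> com_items \<Gamma> c then xi j else xi' j))"

definition wf_game :: "('r, 'm) game_scheme \<Rightarrow> bool" where
  "wf_game \<Gamma> \<longleftrightarrow>
     finite (items \<Gamma>) \<and>
     (\<forall>j\<in>items \<Gamma>. avail \<Gamma> j \<subseteq> players \<Gamma>) \<and>
     (\<forall>j\<in>items \<Gamma>. \<forall>i\<in>avail \<Gamma> j. profit \<Gamma> i j \<ge> 0 \<and> cap \<Gamma> i j \<ge> 0) \<and>
     (\<forall>j\<in>items \<Gamma>. weight \<Gamma> j > 0) \<and>
     0 < pooling \<Gamma> \<and> pooling \<Gamma> \<le> 1 \<and>
     (\<forall>c\<subseteq>players \<Gamma>.
        (\<exists>x y. feasible \<Gamma> c x y) \<and> bdd_above {objective \<Gamma> c x | x y. feasible \<Gamma> c x y}) \<and>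
     (\<forall>c\<subseteq>players \<Gamma>. feasible \<Gamma> c (\<lambda>_ _. 0) (\<lambda>_. 0)) \<and>
     untied \<Gamma>"

definition core :: "('r, 'm) game_scheme \<Rightarrow> nat set \<Rightarrow> (nat \<Rightarrow> real) set" where
  "core \<Gamma> c =
     {w \<in> c \<rightarrow>\<^sub>E UNIV. (\<Sum>i\<in>c. w i) = coal_value \<Gamma> c \<and> (\<forall>s\<subseteq>c. (\<Sum>i\<in>s. w i) \<ge> coal_value \<Gamma> s)}"

definition scs :: "('r, 'm) game_scheme \<Rightarrow> nat set set \<Rightarrow> (nat \<Rightarrow> real) \<Rightarrow> bool" where
  "scs \<Gamma> CS v \<longleftrightarrow>
     partition_on (players \<Gamma>) CS \<and> v \<in> players \<Gamma> \<rightarrow>\<^sub>E UNIV \<and>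
     (\<forall>c\<in>CS. restrict v c \<in> core \<Gamma> c)"

definition stable_payoffs :: "('r, 'm) game_scheme \<Rightarrow> (nat \<Rightarrow> real) set" where
  "stable_payoffs \<Gamma> = {v. \<exists>CS. scs \<Gamma> CS v}"

definition oscs :: "('r, 'm) game_scheme \<Rightarrow> nat set set \<Rightarrow> (nat \<Rightarrow> real) \<Rightarrow> bool" where
  "oscs \<Gamma> CS v \<longleftrightarrow>
     is_arg_max (\<lambda>(CS, v). \<Sum>i\<in>players \<Gamma>. v i) (\<lambda>(CS, v). scs \<Gamma> CS v) (CS, v)"

definition bigM :: "('r, 'm) game_scheme \<Rightarrow> real" where
  "bigM \<Gamma> = (\<Sum>i\<in>players \<Gamma>. \<Sum>j\<in>items_of \<Gamma> i. profit \<Gamma> i j * cap \<Gamma> i j)"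

type_synonym 'r point =
  "(nat \<Rightarrow> real) \<times> (nat \<Rightarrow> nat \<Rightarrow> 'r \<Rightarrow> real) \<times> (nat \<Rightarrow> 'r \<Rightarrow> real) \<times>
   (nat \<Rightarrow> nat \<Rightarrow> real) \<times> (nat \<Rightarrow> real)"

text \<open>
  Points are \<open>(v, x, y, z, \<pi>)\<close> with \<open>x i g j\<close>, \<open>y g j\<close>, \<open>z i g\<close>, \<open>\<pi> g\<close>; groups are indexed by
  players. The auxiliary variables \<open>\<phi>\<close> and \<open>w\<close> are projected out, and \<open>K j\<close> is the big-M constant
  of the pooling constraint for item \<open>j\<close>.
\<close>

definition pooling_constraints ::
    "('r, 'm) game_scheme \<Rightarrow> ('r \<Rightarrow> real) \<Rightarrow> (nat \<Rightarrow> 'r \<Rightarrow> real) \<Rightarrow> (nat \<Rightarrow> nat \<Rightarrow> real)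
      \<Rightarrow> (nat \<Rightarrow> 'r \<Rightarrow> real) \<Rightarrow> bool" where
  "pooling_constraints \<Gamma> K y z w \<longleftrightarrow>
     (\<forall>g\<in>players \<Gamma>. \<forall>j\<in>items \<Gamma>.
        w g j \<in> {0, 1} \<and>
        2 * w g j \<le> (\<Sum>i\<in>avail \<Gamma> j. z i g) \<and>
        (\<Sum>i\<in>avail \<Gamma> j. z i g) \<le> (real (card (avail \<Gamma> j)) - 1) * w g j + 1 \<and>
        y g j \<le> pooling \<Gamma> * (\<Sum>i\<in>avail \<Gamma> j. cap \<Gamma> i j * z i g) + K j * (1 - w g j))"

definition formulation :: "('r, 'm) game_scheme \<Rightarrow> ('r \<Rightarrow> real) \<Rightarrow> 'r point set" where
  "formulation \<Gamma> K =
     {(v, x, y, z, \<pi>). v \<in> players \<Gamma> \<rightarrow>\<^sub>E UNIV \<and>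
       (\<forall>i\<in>players \<Gamma>. (\<Sum>g\<in>players \<Gamma>. z i g) = 1) \<and>
       (\<forall>g\<in>players \<Gamma>. \<pi> g = (\<Sum>j\<in>items \<Gamma>. \<Sum>i\<in>avail \<Gamma> j. profit \<Gamma> i j * x i g j)) \<and>
       (\<exists>\<phi> :: nat \<Rightarrow> nat \<Rightarrow> real.
          (\<forall>g\<in>players \<Gamma>. \<pi> g = (\<Sum>i\<in>players \<Gamma>. \<phi> i g)) \<and>
          (\<forall>i\<in>players \<Gamma>. \<forall>g\<in>players \<Gamma>.
             \<phi> i g \<le> v i \<and> \<phi> i g \<le> bigM \<Gamma> * z i g \<and>
             \<phi> i g \<ge> v i - bigM \<Gamma> * (1 - z i g) \<and> \<phi> i g \<ge> 0)) \<and>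
       (\<forall>g\<in>players \<Gamma>.
          (\<Sum>j\<in>items \<Gamma>. weight \<Gamma> j * y g j) \<le> (\<Sum>i\<in>players \<Gamma>. budget \<Gamma> i * z i g)) \<and>
       (\<forall>g\<in>players \<Gamma>. \<forall>j\<in>items \<Gamma>. y g j = (\<Sum>i\<in>avail \<Gamma> j. x i g j)) \<and>
       (\<forall>i\<in>players \<Gamma>. \<forall>g\<in>players \<Gamma>. \<forall>k<num_private \<Gamma> i.
          private_lhs \<Gamma> i k (x i g) \<le> private_rhs \<Gamma> i k * z i g) \<and>
       (\<forall>g\<in>players \<Gamma>. \<forall>j\<in>items \<Gamma>. \<forall>i\<in>avail \<Gamma> j.
          0 \<le> x i g j \<and> x i g j \<le> cap \<Gamma> i j * z i g) \<and>
       (\<forall>g\<in>players \<Gamma>. \<forall>j\<in>items \<Gamma>. y g j \<le> (\<Sum>i\<in>avail \<Gamma> j. cap \<Gamma> i j * z i g)) \<and>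
       (\<forall>i\<in>players \<Gamma>. \<forall>g\<in>players \<Gamma>. i < g \<longrightarrow> z i g = 0) \<and>
       (\<forall>g\<in>players \<Gamma>. (\<Sum>i\<in>players \<Gamma>. z i g) \<le> real (card (players \<Gamma>)) * z g g) \<and>
       (\<forall>i\<in>players \<Gamma>. v i \<ge> 0) \<and>
       (\<forall>g\<in>players \<Gamma>. \<pi> g \<ge> 0) \<and>
       (\<forall>g\<in>players \<Gamma>. \<forall>j\<in>items \<Gamma>. y g j \<in> \<nat>) \<and>
       (\<forall>i\<in>players \<Gamma>. \<forall>g\<in>players \<Gamma>. z i g \<in> {0, 1}) \<and>
       (pooling \<Gamma> < 1 \<longrightarrow> (\<exists>w. pooling_constraints \<Gamma> K y z w))}"

definition stab_formulation ::
    "('r, 'm) game_scheme \<Rightarrow> ('r \<Rightarrow> real) \<Rightarrow> (nat set \<Rightarrow> real) \<Rightarrow> 'r point set" where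
  "stab_formulation \<Gamma> K M =
     {(v, x, y, z, \<pi>). (v, x, y, z, \<pi>) \<in> formulation \<Gamma> K \<and>
       (\<forall>g\<in>players \<Gamma>. \<forall>s\<subseteq>players \<Gamma>.
          (\<Sum>i\<in>s. v i) \<ge> coal_value \<Gamma> s - M s * (real (card s) - (\<Sum>i\<in>s. z i g)))}"

definition proj_v :: "'r point set \<Rightarrow> (nat \<Rightarrow> real) set" where
  "proj_v P = {v. \<exists>x y z \<pi>. (v, x, y, z, \<pi>) \<in> P}"

text \<open>The coalition structure encoded by the assignment variables; unused groups are dropped.\<close>

definition coalitions_of ::
    "('r, 'm) game_scheme \<Rightarrow> (nat \<Rightarrow> nat \<Rightarrow> real) \<Rightarrow> nat set set" where
  "coalitions_of \<Gamma> z = {{i \<in> players \<Gamma>. z i g = 1} | g. g \<in> players \<Gamma>} - {{}}"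

definition payoff_sum_maximizer ::
    "('r, 'm) game_scheme \<Rightarrow> 'r point set \<Rightarrow> 'r point \<Rightarrow> bool" where
  "payoff_sum_maximizer \<Gamma> P q \<longleftrightarrow> is_arg_max (\<lambda>(v, _). \<Sum>i\<in>players \<Gamma>. v i) (\<lambda>q. q \<in> P) q"

text \<open>The maximum of the capacities is read as \<open>0\<close> for an item that is available to nobody.\<close>

definition max_cap :: "('r, 'm) game_scheme \<Rightarrow> 'r \<Rightarrow> real" where
  "max_cap \<Gamma> j = (if avail \<Gamma> j = {} then 0 else Max ((\<lambda>i. cap \<Gamma> i j) ` avail \<Gamma> j))"

end

theory Submission
  imports Defs
begin

text \<open>
  Fix a group \<open>g\<close> of a point of the formulation and let \<open>c\<close> be the set of its members. The constraints
  that involve \<open>g\<close> say exactly that the slice \<open>x\<^sup>g\<close> is a feasible plan for the program of \<open>c\<close>,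
  extended by zero to nonmembers. Hence \<open>\<Sum>\<^sub>c v = \<pi>\<^sub>g \<le> V(c)\<close>, while the stability cuts with
  \<open>s \<subseteq> c\<close> have a vanishing big-M term, so that \<open>v\<close> restricted to \<open>c\<close> is in the core. Conversely, given
  a stable coalition structure, label each coalition by its least member and use an optimal plan for
  it; such a plan exists because the normalized plans form a compact set. The cuts with \<open>s\<close> not
  inside a group hold because \<open>M\<^sub>s \<ge> V(s)\<close> and \<open>v \<ge> 0\<close>. A maximum of the total payoff exists since
  that total is \<open>\<Sum>\<^sub>c V(c)\<close>, which depends only on one of finitely many partitions.
\<close>

text \<open>
  The aggregates \<open>y\<close> are eliminated, and a single sum over all available players covers the
  individual and the common items, because nonmembers are forced to zero.
\<close>

definition group_plan :: "('r, 'm) game_scheme \<Rightarrow> nat set \<Rightarrow> (nat \<Rightarrow> 'r \<Rightarrow> real) \<Rightarrow> bool" where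
  "group_plan \<Gamma> c x \<longleftrightarrow>
     (\<Sum>j\<in>items \<Gamma>. weight \<Gamma> j * (\<Sum>i\<in>avail \<Gamma> j. x i j)) \<le> (\<Sum>i\<in>c. budget \<Gamma> i) \<and>
     (\<forall>i\<in>c. private_ok \<Gamma> i (x i)) \<and>
     (\<forall>j\<in>items \<Gamma>. \<forall>i\<in>avail \<Gamma> j. 0 \<le> x i j \<and> x i j \<le> (if i \<in> c then cap \<Gamma> i j else 0)) \<and>
     (\<forall>j\<in>items \<Gamma>. (\<Sum>i\<in>avail \<Gamma> j. x i j) \<in> \<nat>) \<and>
     (\<forall>j\<in>items \<Gamma>. 2 \<le> card (coal_avail \<Gamma> c j) \<longrightarrow>
        (\<Sum>i\<in>avail \<Gamma> j. x i j) \<le> pooling \<Gamma> * (\<Sum>i\<in>coal_avail \<Gamma> c j. cap \<Gamma> i j))"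

definition plan_profit :: "('r, 'm) game_scheme \<Rightarrow> (nat \<Rightarrow> 'r \<Rightarrow> real) \<Rightarrow> real" where
  "plan_profit \<Gamma> x = (\<Sum>j\<in>items \<Gamma>. \<Sum>i\<in>avail \<Gamma> j. profit \<Gamma> i j * x i j)"

section \<open>Splitting item sums by availability within a coalition\<close>

lemma finite_players [simp]: "finite (players \<Gamma>)"
  by (simp add: players_def)

lemma wf_game_finite_avail: "wf_game \<Gamma> \<Longrightarrow> j \<in> items \<Gamma> \<Longrightarrow> finite (avail \<Gamma> j)"
  unfolding wf_game_def by (meson finite_players finite_subset)

lemma com_items_eq: "com_items \<Gamma> c = {j \<in> items \<Gamma>. 2 \<le> card (coal_avail \<Gamma> c j)}"
  by (auto simp: com_items_def coal_items_def)

lemma ind_items_eq: "ind_items \<Gamma> c = {j \<in> items \<Gamma>. card (coal_avail \<Gamma> c j) = 1}"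
  by (auto simp: ind_items_def coal_items_def)

lemma coal_items_split:
  assumes "wf_game \<Gamma>"
  shows "coal_items \<Gamma> c = com_items \<Gamma> c \<union> ind_items \<Gamma> c" "com_items \<Gamma> c \<inter> ind_items \<Gamma> c = {}"
proof -
  \<comment> \<open>Finiteness matters here: an infinite set of available members would have
    cardinality 0 and belong to neither kind of item.\<close>
  have *: "card (coal_avail \<Gamma> c j) \<noteq> 0" if "j \<in> coal_items \<Gamma> c" for j
    using that wf_game_finite_avail[OF assms] by (auto simp: coal_items_def coal_avail_def)
  then have "2 \<le> card (coal_avail \<Gamma> c j) \<or> card (coal_avail \<Gamma> c j) = 1" if "j \<in> coal_items \<Gamma> c" for j
    using that[THEN *] by linarith
  then show "coal_items \<Gamma> c = com_items \<Gamma> c \<union> ind_items \<Gamma> c"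
    by (auto simp: com_items_def ind_items_def)
  show "com_items \<Gamma> c \<inter> ind_items \<Gamma> c = {}"
    by (auto simp: com_items_def ind_items_def)
qed

lemma sum_avail_coal:
  fixes f :: "nat \<Rightarrow> real"
  assumes "wf_game \<Gamma>" "j \<in> items \<Gamma>" "\<And>i. i \<in> avail \<Gamma> j - c \<Longrightarrow> f i = 0"
  shows "(\<Sum>i\<in>avail \<Gamma> j. f i) = (\<Sum>i\<in>coal_avail \<Gamma> c j. f i)"
  unfolding coal_avail_def
  by (rule sum.mono_neutral_right) (use assms wf_game_finite_avail in auto)

lemma sum_items_coal:
  fixes f :: "'r \<Rightarrow> real"
  assumes "wf_game \<Gamma>" "\<And>j. j \<in> items \<Gamma> \<Longrightarrow> coal_avail \<Gamma> c j = {} \<Longrightarrow> f j = 0"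
  shows "(\<Sum>j\<in>items \<Gamma>. f j) = (\<Sum>j\<in>coal_items \<Gamma> c. f j)"
  by (rule sum.mono_neutral_right) (use assms in \<open>auto simp: wf_game_def coal_items_def\<close>)

text \<open>The budget row of \<open>feasible\<close> treats common and individual items
  differently, while \<open>group_plan\<close> uses one sum. Items that no member can use must
  contribute 0.\<close>

lemma sum_items_com_ind:
  fixes f :: "'r \<Rightarrow> real"
  assumes "wf_game \<Gamma>" "\<And>j. j \<in> items \<Gamma> \<Longrightarrow> coal_avail \<Gamma> c j = {} \<Longrightarrow> f j = 0"
  shows "(\<Sum>j\<in>items \<Gamma>. f j) = (\<Sum>j\<in>com_items \<Gamma> c. f j) + (\<Sum>j\<in>ind_items \<Gamma> c. f j)"
proof -
  have "finite (com_items \<Gamma> c)" "finite (ind_items \<Gamma> c)"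
    using assms(1) by (auto simp: wf_game_def com_items_eq ind_items_eq)
  then show ?thesis
    using sum_items_coal[OF assms] coal_items_split[OF assms(1), of c]
    by (simp add: sum.union_disjoint)
qed

section \<open>Feasible plans of a coalition and their normalized form\<close>

lemma group_plan_zero: "group_plan \<Gamma> c x \<Longrightarrow> j \<in> items \<Gamma> \<Longrightarrow> i \<in> avail \<Gamma> j \<Longrightarrow> i \<notin> c \<Longrightarrow> x i j = 0"
  unfolding group_plan_def by (force intro: order_antisym)

lemma plan_profit_eq_objective:
  assumes "wf_game \<Gamma>" "\<And>i j. j \<in> items \<Gamma> \<Longrightarrow> i \<in> avail \<Gamma> j - c \<Longrightarrow> x i j = 0"
  shows "plan_profit \<Gamma> x = objective \<Gamma> c x"
proof -
  have "plan_profit \<Gamma> x = (\<Sum>j\<in>items \<Gamma>. \<Sum>i\<in>coal_avail \<Gamma> c j. profit \<Gamma> i j * x i j)"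
    unfolding plan_profit_def by (intro sum.cong refl sum_avail_coal[OF assms(1)]) (use assms(2) in auto)
  also have "\<dots> = objective \<Gamma> c x"
    unfolding objective_def by (rule sum_items_coal[OF assms(1)]) simp
  finally show ?thesis .
qed

text \<open>Nonmembers contribute zero, so the aggregate over all available players is the aggregate
  over members, and each constraint turns into its counterpart.\<close>

lemma group_plan_feasible:
  assumes wf: "wf_game \<Gamma>" and gp: "group_plan \<Gamma> c x"
  shows "feasible \<Gamma> c x (\<lambda>j. \<Sum>i\<in>avail \<Gamma> j. x i j)" "objective \<Gamma> c x = plan_profit \<Gamma> x"
proof -
  have z: "x i j = 0" if "j \<in> items \<Gamma>" "i \<in> avail \<Gamma> j - c" for i j
    using group_plan_zero[OF gp] that by auto
  show "objective \<Gamma> c x = plan_profit \<Gamma> x"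
    using plan_profit_eq_objective[OF wf z] by simp
  have s: "(\<Sum>i\<in>avail \<Gamma> j. x i j) = (\<Sum>i\<in>coal_avail \<Gamma> c j. x i j)" if "j \<in> items \<Gamma>" for j
    by (rule sum_avail_coal[OF wf that]) (use z that in auto)
  have "(\<Sum>j\<in>items \<Gamma>. weight \<Gamma> j * (\<Sum>i\<in>avail \<Gamma> j. x i j))
      = (\<Sum>j\<in>com_items \<Gamma> c. weight \<Gamma> j * (\<Sum>i\<in>avail \<Gamma> j. x i j)) +
        (\<Sum>j\<in>ind_items \<Gamma> c. weight \<Gamma> j * (\<Sum>i\<in>avail \<Gamma> j. x i j))"
    by (rule sum_items_com_ind[OF wf]) (simp add: s)
  also have "(\<Sum>j\<in>ind_items \<Gamma> c. weight \<Gamma> j * (\<Sum>i\<in>avail \<Gamma> j. x i j)) =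
      (\<Sum>j\<in>ind_items \<Gamma> c. \<Sum>i\<in>coal_avail \<Gamma> c j. weight \<Gamma> j * x i j)"
    by (intro sum.cong refl) (simp add: s ind_items_eq sum_distrib_left)
  finally have budget: "(\<Sum>j\<in>com_items \<Gamma> c. weight \<Gamma> j * (\<Sum>i\<in>avail \<Gamma> j. x i j)) +
      (\<Sum>j\<in>ind_items \<Gamma> c. \<Sum>i\<in>coal_avail \<Gamma> c j. weight \<Gamma> j * x i j) \<le> (\<Sum>i\<in>c. budget \<Gamma> i)"
    using gp by (simp add: group_plan_def)
  have box: "box_ok \<Gamma> i (x i)" if "i \<in> c" for i
    using gp that by (fastforce simp: group_plan_def box_ok_def items_of_def)
  \<comment> \<open>An individual item has exactly one available member, whose entry therefore
    equals the integral aggregate.\<close>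
  have nat: "x i j \<in> \<nat>" if "j \<in> ind_items \<Gamma> c" "i \<in> coal_avail \<Gamma> c j" for i j
  proof -
    have "coal_avail \<Gamma> c j = {i}"
      using that by (auto simp: ind_items_eq card_1_singleton_iff)
    moreover have "(\<Sum>i\<in>coal_avail \<Gamma> c j. x i j) \<in> \<nat>"
      using gp s that by (auto simp: group_plan_def ind_items_eq)
    ultimately show ?thesis by simp
  qed
  have nonneg: "0 \<le> (\<Sum>i\<in>avail \<Gamma> j. x i j)" if "j \<in> items \<Gamma>" for j
    using gp that by (auto simp: group_plan_def intro: sum_nonneg)
  show "feasible \<Gamma> c x (\<lambda>j. \<Sum>i\<in>avail \<Gamma> j. x i j)"
    using budget gp s box nat nonneg
    unfolding feasible_def group_plan_def com_items_eq by simp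
qed

lemma feasible_group_plan:
  assumes wf: "wf_game \<Gamma>" and fe: "feasible \<Gamma> c x y"
  defines "x' \<equiv> \<lambda>i j. if i \<in> c \<and> j \<in> items_of \<Gamma> i then x i j else 0"
  shows "group_plan \<Gamma> c x'" "plan_profit \<Gamma> x' = objective \<Gamma> c x"
proof -
  have z: "x' i j = 0" if "j \<in> items \<Gamma>" "i \<in> avail \<Gamma> j - c" for i j
    using that by (simp add: x'_def)
  have eq: "x' i j = x i j" if "j \<in> items \<Gamma>" "i \<in> coal_avail \<Gamma> c j" for i j
    using that by (simp add: x'_def coal_avail_def items_of_def)
  have "plan_profit \<Gamma> x' = objective \<Gamma> c x'"
    using plan_profit_eq_objective[OF wf z] by simp
  also have "\<dots> = objective \<Gamma> c x"
    unfolding objective_def by (intro sum.cong refl) (simp add: eq coal_items_def)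
  finally show "plan_profit \<Gamma> x' = objective \<Gamma> c x" .
  have s: "(\<Sum>i\<in>avail \<Gamma> j. x' i j) = (\<Sum>i\<in>coal_avail \<Gamma> c j. x i j)" if "j \<in> items \<Gamma>" for j
  proof -
    have "(\<Sum>i\<in>avail \<Gamma> j. x' i j) = (\<Sum>i\<in>coal_avail \<Gamma> c j. x' i j)"
      by (rule sum_avail_coal[OF wf that]) (use z that in auto)
    then show ?thesis
      using eq[OF that] by simp
  qed
  have ycom: "y j = (\<Sum>i\<in>coal_avail \<Gamma> c j. x i j)" if "j \<in> com_items \<Gamma> c" for j
    using fe that by (auto simp: feasible_def)
  have "(\<Sum>j\<in>items \<Gamma>. weight \<Gamma> j * (\<Sum>i\<in>avail \<Gamma> j. x' i j))
      = (\<Sum>j\<in>com_items \<Gamma> c. weight \<Gamma> j * (\<Sum>i\<in>avail \<Gamma> j. x' i j)) +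
        (\<Sum>j\<in>ind_items \<Gamma> c. weight \<Gamma> j * (\<Sum>i\<in>avail \<Gamma> j. x' i j))"
    by (rule sum_items_com_ind[OF wf]) (simp add: s)
  also have "(\<Sum>j\<in>com_items \<Gamma> c. weight \<Gamma> j * (\<Sum>i\<in>avail \<Gamma> j. x' i j)) =
      (\<Sum>j\<in>com_items \<Gamma> c. weight \<Gamma> j * y j)"
    by (intro sum.cong refl) (simp add: s ycom com_items_eq)
  also have "(\<Sum>j\<in>ind_items \<Gamma> c. weight \<Gamma> j * (\<Sum>i\<in>avail \<Gamma> j. x' i j)) =
      (\<Sum>j\<in>ind_items \<Gamma> c. \<Sum>i\<in>coal_avail \<Gamma> c j. weight \<Gamma> j * x i j)"
    by (intro sum.cong refl) (simp add: s ind_items_eq sum_distrib_left)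
  finally have budget:
    "(\<Sum>j\<in>items \<Gamma>. weight \<Gamma> j * (\<Sum>i\<in>avail \<Gamma> j. x' i j)) \<le> (\<Sum>i\<in>c. budget \<Gamma> i)"
    using fe unfolding feasible_def by linarith
  have priv: "private_ok \<Gamma> i (x' i)" if "i \<in> c" for i
    using fe that by (simp add: feasible_def private_ok_def private_lhs_def x'_def)
  have box: "0 \<le> x' i j \<and> x' i j \<le> (if i \<in> c then cap \<Gamma> i j else 0)"
    if "j \<in> items \<Gamma>" "i \<in> avail \<Gamma> j" for i j
    using fe that by (auto simp: feasible_def box_ok_def x'_def items_of_def)
  have nat: "(\<Sum>i\<in>avail \<Gamma> j. x' i j) \<in> \<nat>" if "j \<in> items \<Gamma>" for j
  proof (cases "j \<in> coal_items \<Gamma> c")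
    case False
    then show ?thesis using that s by (simp add: coal_items_def)
  next
    case True
    then consider "j \<in> com_items \<Gamma> c" | "j \<in> ind_items \<Gamma> c"
      using coal_items_split[OF wf] by blast
    then show ?thesis
    proof cases
      case 1
      then have "y j \<in> \<nat>" using fe unfolding feasible_def by blast
      then show ?thesis using ycom[OF 1] s[OF that] by simp
    next
      case 2
      then have "\<forall>i\<in>coal_avail \<Gamma> c j. x i j \<in> \<nat>"
        using fe unfolding feasible_def by blast
      moreover obtain i where "coal_avail \<Gamma> c j = {i}"
        using 2 by (auto simp: ind_items_eq card_1_singleton_iff)
      ultimately have "(\<Sum>i\<in>coal_avail \<Gamma> c j. x i j) \<in> \<nat>"
        by simp
      then show ?thesis using s[OF that] by simp
    qed
  qed
  have pool: "(\<Sum>i\<in>avail \<Gamma> j. x' i j) \<le> pooling \<Gamma> * (\<Sum>i\<in>coal_avail \<Gamma> c j. cap \<Gamma> i j)"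
    if "j \<in> items \<Gamma>" "2 \<le> card (coal_avail \<Gamma> c j)" for j
  proof -
    have "j \<in> com_items \<Gamma> c" using that by (simp add: com_items_eq)
    then show ?thesis using fe ycom s[OF that(1)] unfolding feasible_def by metis
  qed
  show "group_plan \<Gamma> c x'"
    using budget priv box nat pool unfolding group_plan_def by blast
qed

section \<open>Attainment of the coalition value\<close>

text \<open>Tychonoff applied twice: a box of curried functions is a product of products.\<close>

lemma compact_function_box:
  fixes S :: "'a \<Rightarrow> 'b \<Rightarrow> 'c::topological_space set"
  assumes "\<And>i j. compact (S i j)"
  shows "compact {x. \<forall>i j. x i j \<in> S i j}"
proof -
  have prod: "compact (PiE UNIV T)" if "\<And>i. compact (T i)"
    for T :: "'d \<Rightarrow> 'e::topological_space set"
    using that compactin_PiE[of "\<lambda>_. euclidean" UNIV T]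
    by (metis compactin_euclidean_iff euclidean_product_topology)
  have "{x. \<forall>i j. x i j \<in> S i j} = PiE UNIV (\<lambda>i. PiE UNIV (S i))"
    by (auto simp: PiE_UNIV_domain)
  then show ?thesis
    using prod[OF prod[OF assms]] by simp
qed

text \<open>A continuous profit on a compact nonempty set of normalized plans has a maximizer, so
  the \<open>GREATEST\<close> in \<open>coal_value\<close> is a genuine maximum. Later the maximizer
  serves to build points, and the bound to limit group profits.\<close>

lemma coal_value_attained:
  fixes \<Gamma> :: "('r, 'm) game_scheme"
  assumes wf: "wf_game \<Gamma>" and c: "c \<subseteq> players \<Gamma>"
  shows "\<exists>x. group_plan \<Gamma> c x \<and> plan_profit \<Gamma> x = coal_value \<Gamma> c \<and>
    (\<forall>x'. group_plan \<Gamma> c x' \<longrightarrow> plan_profit \<Gamma> x' \<le> coal_value \<Gamma> c)"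
proof -
  \<comment> \<open>\<open>group_plan\<close> does not bound entries at inadmissible indices;
    pinning them to 0 gives every coordinate a compact range.\<close>
  define S where "S i j = (if i \<in> c \<and> j \<in> items_of \<Gamma> i then {0..cap \<Gamma> i j} else {0})" for i j
  define F where "F = {x. \<forall>i j. x i j \<in> S i j} \<inter> {x. group_plan \<Gamma> c x}"
  have coord: "continuous_on UNIV (\<lambda>x :: nat \<Rightarrow> 'r \<Rightarrow> real. x i j)" for i j
    by (rule continuous_on_product_then_coordinatewise[OF continuous_on_product_coordinates])
  have lin: "continuous_on UNIV (\<lambda>x :: nat \<Rightarrow> 'r \<Rightarrow> real. \<Sum>i\<in>I. a i * x i j)" for I a j
    by (rule continuous_on_sum, rule continuous_on_mult, rule continuous_on_const, rule coord)
  have lin': "continuous_on UNIV (\<lambda>x :: nat \<Rightarrow> 'r \<Rightarrow> real. \<Sum>j\<in>J. a j * x i j)" for J a i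
    by (rule continuous_on_sum, rule continuous_on_mult, rule continuous_on_const, rule coord)
  have sum: "continuous_on UNIV (\<lambda>x :: nat \<Rightarrow> 'r \<Rightarrow> real. \<Sum>i\<in>I. x i j)" for I j
    by (rule continuous_on_sum, rule coord)
  have dbl: "continuous_on UNIV (\<lambda>x :: nat \<Rightarrow> 'r \<Rightarrow> real. \<Sum>j\<in>J. w j * (\<Sum>i\<in>I j. x i j))" for I J w
    by (rule continuous_on_sum, rule continuous_on_mult, rule continuous_on_const, rule sum)
  \<comment> \<open>Integrality is a closed condition: the aggregate is continuous in the plan and
    the naturals are closed in the reals.\<close>
  have Nats: "closed {x :: nat \<Rightarrow> 'r \<Rightarrow> real. (\<Sum>i\<in>avail \<Gamma> j. x i j) \<in> \<nat>}" for j
    by (rule closed_vimage[unfolded vimage_def, OF closed_Nats sum])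
  \<comment> \<open>The premises, such as membership and the cardinality test, do not mention
    \<open>x\<close>, so they define open sets and each implication is closed.\<close>
  have closed: "closed {x. group_plan \<Gamma> c x}"
    unfolding group_plan_def private_ok_def private_lhs_def Ball_def
    by (intro closed_Collect_conj closed_Collect_all closed_Collect_imp open_Collect_const Nats
        closed_Collect_le continuous_on_const lin lin' sum dbl coord)
  have "compact {x. \<forall>i j. x i j \<in> S i j}"
    by (rule compact_function_box) (simp add: S_def)
  then have comp: "compact F"
    unfolding F_def by (rule compact_Int_closed[OF _ closed])
  have trunc: "\<exists>x'\<in>F. plan_profit \<Gamma> x' = objective \<Gamma> c x" if "feasible \<Gamma> c x y" for x y
  proof -
    define x' where "x' = (\<lambda>i j. if i \<in> c \<and> j \<in> items_of \<Gamma> i then x i j else 0)"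
    have "x' i j \<in> S i j" for i j
      using that by (auto simp: S_def x'_def feasible_def box_ok_def)
    then have "x' \<in> F"
      using feasible_group_plan(1)[OF wf that] by (simp add: F_def x'_def)
    then show ?thesis
      using feasible_group_plan(2)[OF wf that] unfolding x'_def by blast
  qed
  have "feasible \<Gamma> c (\<lambda>_ _. 0) (\<lambda>_. 0)"
    using wf c by (simp add: wf_game_def)
  from trunc[OF this] have "F \<noteq> {}" by auto
  moreover have "continuous_on F (plan_profit \<Gamma>)"
    unfolding plan_profit_def[abs_def]
    by (rule continuous_on_subset[OF _ subset_UNIV], rule continuous_on_sum, rule lin)
  ultimately obtain x where x: "x \<in> F" "\<And>x'. x' \<in> F \<Longrightarrow> plan_profit \<Gamma> x' \<le> plan_profit \<Gamma> x"
    using continuous_attains_sup[OF comp] by blast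
  have gp: "group_plan \<Gamma> c x" using x by (simp add: F_def)
  have max: "objective \<Gamma> c x' \<le> plan_profit \<Gamma> x" if "feasible \<Gamma> c x' y'" for x' y'
    using trunc[OF that] x(2) by metis
  have "coal_value \<Gamma> c = plan_profit \<Gamma> x"
  \<comment> \<open>The value of the empty coalition is 0 by convention; this agrees with the
    maximum, since without members every objective is 0.\<close>
  proof (cases "c = {}")
    case True
    then have "objective \<Gamma> c x = 0"
      by (simp add: objective_def coal_avail_def)
    then show ?thesis
      using True group_plan_feasible(2)[OF wf gp] by (simp add: coal_value_def)
  next
    case False
    have "(GREATEST r. \<exists>x y. feasible \<Gamma> c x y \<and> r = objective \<Gamma> c x) = plan_profit \<Gamma> x"
      using group_plan_feasible[OF wf gp] max by (intro Greatest_equality) (metis, blast)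
    then show ?thesis using False by (simp add: coal_value_def)
  qed
  then show ?thesis
    using gp max group_plan_feasible[OF wf] by metis
qed

section \<open>Zero-one sums and elementary facts on stable structures\<close>

lemma sum_mult_01:
  fixes f z :: "'a \<Rightarrow> real"
  assumes "finite A" "\<And>i. i \<in> A \<Longrightarrow> z i \<in> {0, 1}"
  shows "(\<Sum>i\<in>A. f i * z i) = (\<Sum>i\<in>{i \<in> A. z i = 1}. f i)"
  unfolding sum.inter_filter[OF assms(1)]
proof (intro sum.cong refl)
  fix i assume "i \<in> A"
  then show "f i * z i = (if z i = 1 then f i else 0)" using assms(2)[of i] by auto
qed

lemma sum_01:
  fixes z :: "'a \<Rightarrow> real"
  assumes "finite A" "\<And>i. i \<in> A \<Longrightarrow> z i \<in> {0, 1}"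
  shows "(\<Sum>i\<in>A. z i) = real (card {i \<in> A. z i = 1})"
  using sum_mult_01[OF assms, where f = "\<lambda>_. 1"] by simp

text \<open>Core membership only involves sums over subsets of \<open>c\<close>, on which
  \<open>restrict v c\<close> agrees with \<open>v\<close>.\<close>

lemma scs_iff:
  "scs \<Gamma> CS v \<longleftrightarrow> partition_on (players \<Gamma>) CS \<and> v \<in> players \<Gamma> \<rightarrow>\<^sub>E UNIV \<and>
    (\<forall>c\<in>CS. sum v c = coal_value \<Gamma> c \<and> (\<forall>s\<subseteq>c. coal_value \<Gamma> s \<le> sum v s))"
proof -
  have "sum (restrict v c) s = sum v s" if "s \<subseteq> c" for c s
    using that by (intro sum.cong) auto
  then show ?thesis
    unfolding scs_def core_def by auto
qed

lemma scs_sum_payoffs: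
  assumes "scs \<Gamma> CS v"
  shows "(\<Sum>i\<in>players \<Gamma>. v i) = (\<Sum>c\<in>CS. coal_value \<Gamma> c)"
proof -
  have part: "partition_on (players \<Gamma>) CS"
    using assms by (simp add: scs_iff)
  then have U: "players \<Gamma> = \<Union>CS" and "disjoint CS"
    by (auto simp: partition_on_def)
  then have "sum v (\<Union>CS) = (\<Sum>c\<in>CS. sum v c)"
    by (subst sum.Union_disjoint)
      (auto simp: disjoint_def intro: finite_subset[OF _ finite_players[of \<Gamma>]])
  then show ?thesis
    using U assms by (simp add: scs_iff)
qed

lemma coal_value_empty [simp]: "coal_value \<Gamma> {} = 0"
  by (simp add: coal_value_def)

text \<open>All players stay alone and receive their own value; the only subcoalitions to check are
  the singleton itself and the empty set.\<close>

lemma ex_scs: "\<exists>CS v. scs \<Gamma> CS v"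
proof -
  let ?v = "restrict (\<lambda>i. coal_value \<Gamma> {i}) (players \<Gamma>)"
  have "coal_value \<Gamma> s \<le> sum ?v s" if "s \<subseteq> {i}" "i \<in> players \<Gamma>" for s i
    using that by (auto simp: subset_singleton_iff)
  then have "scs \<Gamma> ((\<lambda>i. {i}) ` players \<Gamma>) ?v"
    by (auto simp: scs_iff partition_on_singletons)
  then show ?thesis by blast
qed

section \<open>Upper bounds for plan profits and capacities\<close>

lemma group_plan_le_coal_value:
  "wf_game \<Gamma> \<Longrightarrow> c \<subseteq> players \<Gamma> \<Longrightarrow> group_plan \<Gamma> c x \<Longrightarrow> plan_profit \<Gamma> x \<le> coal_value \<Gamma> c"
  using coal_value_attained by blast

text \<open>Entries are at most the capacities and profits are nonnegative; exchanging the order of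
  summation then yields \<open>bigM\<close>. This is what makes \<open>bigM\<close> large enough for
  individual payoffs.\<close>

lemma plan_profit_le_bigM:
  assumes wf: "wf_game \<Gamma>" and gp: "group_plan \<Gamma> c x"
  shows "plan_profit \<Gamma> x \<le> bigM \<Gamma>"
proof -
  have "plan_profit \<Gamma> x \<le> (\<Sum>j\<in>items \<Gamma>. \<Sum>i\<in>avail \<Gamma> j. profit \<Gamma> i j * cap \<Gamma> i j)"
    unfolding plan_profit_def
  proof (intro sum_mono mult_left_mono)
    fix j i assume ji: "j \<in> items \<Gamma>" "i \<in> avail \<Gamma> j"
    then have "0 \<le> cap \<Gamma> i j" "x i j \<le> (if i \<in> c then cap \<Gamma> i j else 0)"
      using wf gp by (auto simp: wf_game_def group_plan_def)
    then show "x i j \<le> cap \<Gamma> i j" by (auto split: if_splits)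
    show "0 \<le> profit \<Gamma> i j" using wf ji by (simp add: wf_game_def)
  qed
  also have "\<dots> = (\<Sum>j\<in>items \<Gamma>. \<Sum>i\<in>{i \<in> players \<Gamma>. i \<in> avail \<Gamma> j}. profit \<Gamma> i j * cap \<Gamma> i j)"
    using wf by (intro sum.cong refl) (auto simp: wf_game_def)
  also have "\<dots> = bigM \<Gamma>"
    unfolding bigM_def items_of_def
    by (rule sum.swap_restrict[symmetric]) (use wf in \<open>auto simp: wf_game_def\<close>)
  finally show ?thesis .
qed

lemma max_cap_ge:
  assumes "wf_game \<Gamma>" "j \<in> items \<Gamma>"
  shows "i \<in> avail \<Gamma> j \<Longrightarrow> cap \<Gamma> i j \<le> max_cap \<Gamma> j" "0 \<le> max_cap \<Gamma> j"
proof -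
  show le: "cap \<Gamma> i j \<le> max_cap \<Gamma> j" if "i \<in> avail \<Gamma> j" for i
    using that wf_game_finite_avail[OF assms] by (auto simp: max_cap_def)
  show "0 \<le> max_cap \<Gamma> j"
  proof (cases "avail \<Gamma> j = {}")
    case False
    then obtain i where i: "i \<in> avail \<Gamma> j" by blast
    then have "0 \<le> cap \<Gamma> i j" using assms by (simp add: wf_game_def)
    then show ?thesis using le[OF i] by linarith
  qed (simp add: max_cap_def)
qed

section \<open>From a point of the formulation to a stable structure\<close>

text \<open>A row of zero-one entries summing to 1 has exactly one entry 1, so each player belongs
  to exactly one group.\<close>

lemma partition_on_coalitions_of:
  assumes z: "\<And>i g. i \<in> players \<Gamma> \<Longrightarrow> g \<in> players \<Gamma> \<Longrightarrow> z i g \<in> {0, 1}"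
    and one: "\<And>i. i \<in> players \<Gamma> \<Longrightarrow> (\<Sum>g\<in>players \<Gamma>. z i g) = 1"
  shows "partition_on (players \<Gamma>) (coalitions_of \<Gamma> z)"
proof -
  have ex1: "\<exists>g. {g \<in> players \<Gamma>. z i g = 1} = {g}" if i: "i \<in> players \<Gamma>" for i
  proof -
    have "real (card {g \<in> players \<Gamma>. z i g = 1}) = 1"
      using one[OF i] sum_01[of "players \<Gamma>" "z i"] z[OF i] by simp
    then show ?thesis by (simp add: card_1_singleton_iff)
  qed
  have ex: "\<exists>g\<in>players \<Gamma>. z i g = 1" if "i \<in> players \<Gamma>" for i
    using ex1[OF that] by (auto simp: set_eq_iff)
  have uniq: "g = g'"
    if "i \<in> players \<Gamma>" "g \<in> players \<Gamma>" "g' \<in> players \<Gamma>" "z i g = 1" "z i g' = 1" for i g g'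
  proof -
    from ex1[OF that(1)] obtain h where h: "{g \<in> players \<Gamma>. z i g = 1} = {h}" by blast
    have "g \<in> {h}" "g' \<in> {h}" using that by (simp_all flip: h)
    then show ?thesis by simp
  qed
  show ?thesis
  proof (rule partition_onI)
    show "\<Union>(coalitions_of \<Gamma> z) = players \<Gamma>"
    proof
      show "\<Union>(coalitions_of \<Gamma> z) \<subseteq> players \<Gamma>" by (auto simp: coalitions_of_def)
      show "players \<Gamma> \<subseteq> \<Union>(coalitions_of \<Gamma> z)"
      proof
        fix i assume "i \<in> players \<Gamma>"
        with ex[OF this] obtain g where "g \<in> players \<Gamma>" "i \<in> {i \<in> players \<Gamma>. z i g = 1}" by blast
        then show "i \<in> \<Union>(coalitions_of \<Gamma> z)"
          unfolding coalitions_of_def by (intro UnionI[of "{i \<in> players \<Gamma>. z i g = 1}"]) blast+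
      qed
    qed
    show "{} \<notin> coalitions_of \<Gamma> z" by (simp add: coalitions_of_def)
    fix p q assume pq: "p \<in> coalitions_of \<Gamma> z" "q \<in> coalitions_of \<Gamma> z" "p \<noteq> q"
    then obtain g h where "g \<in> players \<Gamma>" "p = {i \<in> players \<Gamma>. z i g = 1}"
      "h \<in> players \<Gamma>" "q = {i \<in> players \<Gamma>. z i h = 1}"
      by (auto simp: coalitions_of_def)
    with pq(3) uniq[of _ g h] show "disjnt p q"
      by (auto simp: disjnt_iff)
  qed
qed

lemma formulationD:
  assumes "(v, x, y, z, \<pi>) \<in> formulation \<Gamma> K"
  shows formulation_ext: "v \<in> players \<Gamma> \<rightarrow>\<^sub>E UNIV"
    and formulation_assigned [rule_format]: "\<forall>i\<in>players \<Gamma>. (\<Sum>g\<in>players \<Gamma>. z i g) = 1"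
    and formulation_profit [rule_format]: "\<forall>g\<in>players \<Gamma>.
      \<pi> g = (\<Sum>j\<in>items \<Gamma>. \<Sum>i\<in>avail \<Gamma> j. profit \<Gamma> i j * x i g j)"
    and formulation_budget [rule_format]: "\<forall>g\<in>players \<Gamma>.
      (\<Sum>j\<in>items \<Gamma>. weight \<Gamma> j * y g j) \<le> (\<Sum>i\<in>players \<Gamma>. budget \<Gamma> i * z i g)"
    and formulation_total [rule_format]: "\<forall>g\<in>players \<Gamma>. \<forall>j\<in>items \<Gamma>.
      y g j = (\<Sum>i\<in>avail \<Gamma> j. x i g j)"
    and formulation_private [rule_format]: "\<forall>i\<in>players \<Gamma>. \<forall>g\<in>players \<Gamma>.
      \<forall>k<num_private \<Gamma> i. private_lhs \<Gamma> i k (x i g) \<le> private_rhs \<Gamma> i k * z i g"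
    and formulation_box [rule_format]: "\<forall>g\<in>players \<Gamma>. \<forall>j\<in>items \<Gamma>. \<forall>i\<in>avail \<Gamma> j.
      0 \<le> x i g j \<and> x i g j \<le> cap \<Gamma> i j * z i g"
    and formulation_cap [rule_format]: "\<forall>g\<in>players \<Gamma>. \<forall>j\<in>items \<Gamma>.
      y g j \<le> (\<Sum>i\<in>avail \<Gamma> j. cap \<Gamma> i j * z i g)"
    and formulation_Nats [rule_format]: "\<forall>g\<in>players \<Gamma>. \<forall>j\<in>items \<Gamma>. y g j \<in> \<nat>"
    and formulation_01 [rule_format]: "\<forall>i\<in>players \<Gamma>. \<forall>g\<in>players \<Gamma>. z i g \<in> {0, 1}"
    and formulation_pooling: "pooling \<Gamma> < 1 \<longrightarrow> (\<exists>w. pooling_constraints \<Gamma> K y z w)"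
    and formulation_split_payoff: "\<exists>\<phi> :: nat \<Rightarrow> nat \<Rightarrow> real.
      (\<forall>g\<in>players \<Gamma>. \<pi> g = (\<Sum>i\<in>players \<Gamma>. \<phi> i g)) \<and>
      (\<forall>i\<in>players \<Gamma>. \<forall>g\<in>players \<Gamma>.
         \<phi> i g \<le> v i \<and> \<phi> i g \<le> bigM \<Gamma> * z i g \<and>
         \<phi> i g \<ge> v i - bigM \<Gamma> * (1 - z i g) \<and> \<phi> i g \<ge> 0)"
  using assms unfolding formulation_def mem_Collect_eq case_prod_conv
  by - (elim conjE, assumption)+

text \<open>Since \<open>z\<close> is zero-one, sums weighted by \<open>z\<close> become sums over
  members, and the box constraint forces nonmembers to zero. The pooling bound needs a case split on
  \<open>pooling \<Gamma> < 1\<close>.\<close>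

lemma formulation_group_plan:
  assumes wf: "wf_game \<Gamma>" and F: "(v, x, y, z, \<pi>) \<in> formulation \<Gamma> K" and g: "g \<in> players \<Gamma>"
  shows "group_plan \<Gamma> {i \<in> players \<Gamma>. z i g = 1} (\<lambda>i. x i g)"
proof -
  let ?c = "{i \<in> players \<Gamma>. z i g = 1}"
  have z: "z i g \<in> {0, 1}" if "i \<in> players \<Gamma>" for i
    using formulation_01[OF F that g] .
  have av: "avail \<Gamma> j \<subseteq> players \<Gamma>" if "j \<in> items \<Gamma>" for j
    using wf that by (simp add: wf_game_def)
  have coal: "coal_avail \<Gamma> ?c j = {i \<in> avail \<Gamma> j. z i g = 1}" if "j \<in> items \<Gamma>" for j
    using av[OF that] by (auto simp: coal_avail_def)
  note y = formulation_total[OF F g]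
  have capsum: "(\<Sum>i\<in>avail \<Gamma> j. cap \<Gamma> i j * z i g) = (\<Sum>i\<in>coal_avail \<Gamma> ?c j. cap \<Gamma> i j)"
    if "j \<in> items \<Gamma>" for j
    unfolding coal[OF that] by (rule sum_mult_01) (use that av z wf_game_finite_avail[OF wf] in blast)+
  have "(\<Sum>i\<in>players \<Gamma>. budget \<Gamma> i * z i g) = (\<Sum>i\<in>?c. budget \<Gamma> i)"
    using z by (intro sum_mult_01) auto
  then have "(\<Sum>j\<in>items \<Gamma>. weight \<Gamma> j * (\<Sum>i\<in>avail \<Gamma> j. x i g j)) \<le> (\<Sum>i\<in>?c. budget \<Gamma> i)"
    using formulation_budget[OF F g] y by simp
  moreover have "private_ok \<Gamma> i (x i g)" if "i \<in> ?c" for i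
    using formulation_private[OF F _ g, of i] that by (simp add: private_ok_def)
  moreover have "0 \<le> x i g j \<and> x i g j \<le> (if i \<in> ?c then cap \<Gamma> i j else 0)"
    if "j \<in> items \<Gamma>" "i \<in> avail \<Gamma> j" for i j
  proof -
    have "i \<in> players \<Gamma>" using av that by blast
    then show ?thesis using formulation_box[OF F g that] z[of i] by auto
  qed
  moreover have "(\<Sum>i\<in>avail \<Gamma> j. x i g j) \<in> \<nat>" if "j \<in> items \<Gamma>" for j
    using formulation_Nats[OF F g that] y[OF that] by simp
  moreover have "(\<Sum>i\<in>avail \<Gamma> j. x i g j) \<le> pooling \<Gamma> * (\<Sum>i\<in>coal_avail \<Gamma> ?c j. cap \<Gamma> i j)"
    if j: "j \<in> items \<Gamma>" and two: "2 \<le> card (coal_avail \<Gamma> ?c j)" for j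
  proof (cases "pooling \<Gamma> < 1")
    case True
    then obtain w where "pooling_constraints \<Gamma> K y z w"
      using formulation_pooling[OF F] by blast
    then have w: "w g j \<in> {0, 1}"
      "(\<Sum>i\<in>avail \<Gamma> j. z i g) \<le> (real (card (avail \<Gamma> j)) - 1) * w g j + 1"
      "y g j \<le> pooling \<Gamma> * (\<Sum>i\<in>avail \<Gamma> j. cap \<Gamma> i j * z i g) + K j * (1 - w g j)"
      using g j unfolding pooling_constraints_def by blast+
    \<comment> \<open>With at least two available members, \<open>w g j = 0\<close> is impossible,
      as it would bound their number by 1. Hence \<open>w g j = 1\<close> and the \<open>K j\<close>
      term vanishes.\<close>
    have "(\<Sum>i\<in>avail \<Gamma> j. z i g) = real (card (coal_avail \<Gamma> ?c j))"
      unfolding coal[OF j] by (rule sum_01) (use j av z wf_game_finite_avail[OF wf] in blast)+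
    then have "w g j = 1" using w(1,2) two by auto
    then show ?thesis using w(3) y[OF j] capsum[OF j] by simp
  next
    case False
    \<comment> \<open>With full pooling the plain capacity constraint is the pooling bound.\<close>
    then have "pooling \<Gamma> = 1" using wf by (simp add: wf_game_def)
    then show ?thesis using formulation_cap[OF F g j] y[OF j] capsum[OF j] by simp
  qed
  ultimately show ?thesis unfolding group_plan_def by blast
qed

lemma formulation_payoff:
  assumes F: "(v, x, y, z, \<pi>) \<in> formulation \<Gamma> K" and g: "g \<in> players \<Gamma>"
  shows "plan_profit \<Gamma> (\<lambda>i. x i g) = (\<Sum>i\<in>{i \<in> players \<Gamma>. z i g = 1}. v i)"
proof -
  obtain \<phi> where \<phi>: "\<pi> g = (\<Sum>i\<in>players \<Gamma>. \<phi> i g)"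
    and b: "\<And>i. i \<in> players \<Gamma> \<Longrightarrow> \<phi> i g \<le> v i \<and> \<phi> i g \<le> bigM \<Gamma> * z i g \<and>
             \<phi> i g \<ge> v i - bigM \<Gamma> * (1 - z i g) \<and> \<phi> i g \<ge> 0"
    using formulation_split_payoff[OF F] g by blast
  have z: "z i g \<in> {0, 1}" if "i \<in> players \<Gamma>" for i
    using formulation_01[OF F that g] .
  have "plan_profit \<Gamma> (\<lambda>i. x i g) = \<pi> g"
    using formulation_profit[OF F g] by (simp add: plan_profit_def)
  \<comment> \<open>The linearization pins \<open>\<phi> i g\<close>: between \<open>v i\<close> and
    \<open>v i\<close> when \<open>z i g = 1\<close>, between 0 and 0 when
    \<open>z i g = 0\<close>.\<close>
  also have "\<pi> g = (\<Sum>i\<in>players \<Gamma>. v i * z i g)"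
    unfolding \<phi> by (intro sum.cong refl) (use z b in force)
  also have "\<dots> = (\<Sum>i\<in>{i \<in> players \<Gamma>. z i g = 1}. v i)"
    by (rule sum_mult_01) (use z in auto)
  finally show ?thesis .
qed

lemma stab_formulation_scs:
  assumes wf: "wf_game \<Gamma>" and F: "(v, x, y, z, \<pi>) \<in> stab_formulation \<Gamma> K M"
  shows "scs \<Gamma> (coalitions_of \<Gamma> z) v"
proof -
  have F': "(v, x, y, z, \<pi>) \<in> formulation \<Gamma> K"
    and stab: "\<And>g s. g \<in> players \<Gamma> \<Longrightarrow> s \<subseteq> players \<Gamma> \<Longrightarrow>
      coal_value \<Gamma> s - M s * (real (card s) - (\<Sum>i\<in>s. z i g)) \<le> (\<Sum>i\<in>s. v i)"
    using F by (auto simp: stab_formulation_def)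
  have "partition_on (players \<Gamma>) (coalitions_of \<Gamma> z)"
    by (rule partition_on_coalitions_of) (use formulation_01[OF F'] formulation_assigned[OF F'] in blast)+
  moreover have "v \<in> players \<Gamma> \<rightarrow>\<^sub>E UNIV"
    using formulation_ext[OF F'] .
  moreover have "sum v c = coal_value \<Gamma> c \<and> (\<forall>s\<subseteq>c. coal_value \<Gamma> s \<le> sum v s)"
    if "c \<in> coalitions_of \<Gamma> z" for c
  proof -
    obtain g where g: "g \<in> players \<Gamma>" and c: "c = {i \<in> players \<Gamma>. z i g = 1}"
      using \<open>c \<in> coalitions_of \<Gamma> z\<close> by (auto simp: coalitions_of_def)
    have lower: "coal_value \<Gamma> s \<le> sum v s" if "s \<subseteq> c" for s
    proof -
      have "(\<Sum>i\<in>s. z i g) = (\<Sum>i\<in>s. 1)"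
        using that c by (intro sum.cong) auto
      then show ?thesis
        using stab[OF g, of s] that c by auto
    qed
    have "sum v c \<le> coal_value \<Gamma> c"
      using group_plan_le_coal_value[OF wf _ formulation_group_plan[OF wf F' g]]
        formulation_payoff[OF F' g] c by auto
    \<comment> \<open>The reverse inequality is the instance \<open>s = c\<close> of
      \<open>lower\<close>.\<close>
    then show ?thesis
      using lower by (simp add: order_antisym)
  qed
  ultimately show ?thesis unfolding scs_iff by blast
qed

section \<open>From a stable structure to a point of the formulation\<close>

text \<open>Shows that \<open>K j\<close> is large enough when nothing is pooled: the capacity sum
  has at most one term, so the missing fraction \<open>1 - pooling \<Gamma>\<close> of it is covered
  by \<open>K j\<close>.\<close>

lemma card_le_1_pooling:
  assumes wf: "wf_game \<Gamma>" and j: "j \<in> items \<Gamma>" and K: "(1 - pooling \<Gamma>) * max_cap \<Gamma> j \<le> K j"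
    and card: "card (coal_avail \<Gamma> c j) < 2"
  shows "(\<Sum>i\<in>coal_avail \<Gamma> c j. cap \<Gamma> i j) \<le>
    pooling \<Gamma> * (\<Sum>i\<in>coal_avail \<Gamma> c j. cap \<Gamma> i j) + K j"
proof -
  let ?S = "\<Sum>i\<in>coal_avail \<Gamma> c j. cap \<Gamma> i j"
  have fin: "finite (coal_avail \<Gamma> c j)"
    using wf_game_finite_avail[OF wf j] by (simp add: coal_avail_def)
  consider "coal_avail \<Gamma> c j = {}" | i where "coal_avail \<Gamma> c j = {i}"
    using card fin by (metis One_nat_def card_0_eq card_1_singletonE less_2_cases_iff)
  then have "?S \<le> max_cap \<Gamma> j"
  proof cases
    case 1
    then show ?thesis using max_cap_ge(2)[OF wf j] by simp
  next
    case 2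
    then have "i \<in> avail \<Gamma> j" by (auto simp: coal_avail_def)
    then show ?thesis using 2 max_cap_ge(1)[OF wf j] by simp
  qed
  moreover have "pooling \<Gamma> \<le> 1" using wf by (simp add: wf_game_def)
  ultimately have "(1 - pooling \<Gamma>) * ?S \<le> (1 - pooling \<Gamma>) * max_cap \<Gamma> j"
    by (intro mult_left_mono) auto
  then show ?thesis using K by (simp add: algebra_simps)
qed

lemma scs_stab_formulation:
  fixes \<Gamma> :: "('r, 'm) game_scheme"
  assumes wf: "wf_game \<Gamma>"
    and K: "pooling \<Gamma> < 1 \<Longrightarrow> \<forall>j\<in>items \<Gamma>. K j \<ge> (1 - pooling \<Gamma>) * max_cap \<Gamma> j"
    and M: "\<forall>s\<subseteq>players \<Gamma>. M s \<ge> max (coal_value \<Gamma> s) 0"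
    and V0: "\<forall>i\<in>players \<Gamma>. coal_value \<Gamma> {i} \<ge> 0"
    and scs: "scs \<Gamma> CS v"
  shows "\<exists>x y z \<pi>. (v, x, y, z, \<pi>) \<in> stab_formulation \<Gamma> K M"
proof -
  have part: "partition_on (players \<Gamma>) CS" and ext: "v \<in> players \<Gamma> \<rightarrow>\<^sub>E UNIV"
    and eff: "\<And>c. c \<in> CS \<Longrightarrow> sum v c = coal_value \<Gamma> c"
    and stable: "\<And>c s. c \<in> CS \<Longrightarrow> s \<subseteq> c \<Longrightarrow> coal_value \<Gamma> s \<le> sum v s"
    using scs by (auto simp: scs_iff)
  have U: "\<Union>CS = players \<Gamma>" and disj: "\<And>c c' i. c \<in> CS \<Longrightarrow> c' \<in> CS \<Longrightarrow> i \<in> c \<Longrightarrow> i \<in> c' \<Longrightarrow> c = c'"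
    and ne: "\<And>c. c \<in> CS \<Longrightarrow> c \<noteq> {}"
    using part by (auto simp: partition_on_def disjoint_def)
  have fin: "finite c" if "c \<in> CS" for c
    using that U finite_players[of \<Gamma>] by (metis Union_upper finite_subset)
  define C where "C g = {i. \<exists>c\<in>CS. i \<in> c \<and> g = Min c}" for g
  have C_eq: "C (Min c) = c" if "c \<in> CS" for c
  proof -
    \<comment> \<open>Blocks with the same least member share that member, hence coincide.\<close>
    have "c' = c" if "c' \<in> CS" "Min c' = Min c" for c'
      using that \<open>c \<in> CS\<close> disj ne fin by (metis Min_in)
    then show ?thesis using that by (auto simp: C_def)
  qed
  have C_cases: "C g = {} \<or> (C g \<in> CS \<and> g = Min (C g))" for g
    using C_eq by (auto simp: C_def)
  have C_sub: "C g \<subseteq> players \<Gamma>" for g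
    using U by (auto simp: C_def)
  have C_le: "g \<le> i" if "i \<in> C g" for i g
    using that fin by (auto simp: C_def)
  have C_rep: "g \<in> C g" if "C g \<noteq> {}" for g
    using that C_cases[of g] fin by (metis Min_in)
  have C_ex1: "\<exists>g\<in>players \<Gamma>. \<forall>h. i \<in> C h \<longleftrightarrow> h = g" if "i \<in> players \<Gamma>" for i
  proof -
    obtain c where c: "c \<in> CS" "i \<in> c" using \<open>i \<in> players \<Gamma>\<close> U by blast
    then have "\<forall>h. i \<in> C h \<longleftrightarrow> h = Min c" using disj by (auto simp: C_def)
    moreover have "Min c \<in> players \<Gamma>" using c U fin Min_in ne by blast
    ultimately show ?thesis by blast
  qed
  have CV: "sum v (C g) = coal_value \<Gamma> (C g)" for g
    using C_cases[of g] eff by auto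
  have C_stable: "coal_value \<Gamma> s \<le> sum v s" if "s \<subseteq> C g" for s g
    using C_cases[of g] stable that by auto
  \<comment> \<open>Optimal plans are chosen for all labels at once; an empty group gets a plan of
    value 0.\<close>
  obtain X where X: "\<And>g. group_plan \<Gamma> (C g) (X g)"
    and XV: "\<And>g. plan_profit \<Gamma> (X g) = coal_value \<Gamma> (C g)"
    using coal_value_attained[OF wf C_sub] by metis
  \<comment> \<open>The singleton is a subcoalition of the player's own coalition, so stability and
    the hypothesis on singleton values apply.\<close>
  have v0: "0 \<le> v i" if "i \<in> players \<Gamma>" for i
  proof -
    from C_ex1[OF that] obtain g where "i \<in> C g" by blast
    then show ?thesis using C_stable[of "{i}" g] V0 that by force
  qed
  \<comment> \<open>By nonnegativity a payoff is at most the total of its coalition, which is the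
    profit of a plan. The linearization needs this bound for members and nonmembers alike.\<close>
  have vM: "v i \<le> bigM \<Gamma>" if "i \<in> players \<Gamma>" for i
  proof -
    from C_ex1[OF that] obtain g where g: "i \<in> C g" by blast
    have "v i \<le> sum v (C g)"
      using g C_sub v0 by (intro member_le_sum) (auto intro: finite_subset[OF _ finite_players[of \<Gamma>]])
    also have "\<dots> \<le> bigM \<Gamma>"
      using plan_profit_le_bigM[OF wf X] XV CV by simp
    finally show ?thesis .
  qed

  define z :: "nat \<Rightarrow> nat \<Rightarrow> real" where "z i g = of_bool (i \<in> C g)" for i g
  define x where "x i g j = X g i j" for i g j
  define y where "y g j = (\<Sum>i\<in>avail \<Gamma> j. x i g j)" for g j
  define \<pi> where "\<pi> g = plan_profit \<Gamma> (X g)" for g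
  have Xbox: "0 \<le> x i g j \<and> x i g j \<le> cap \<Gamma> i j * z i g" if "j \<in> items \<Gamma>" "i \<in> avail \<Gamma> j" for i g j
  proof -
    have "0 \<le> X g i j \<and> X g i j \<le> (if i \<in> C g then cap \<Gamma> i j else 0)"
      using X[of g] that unfolding group_plan_def by blast
    then show ?thesis by (auto simp: x_def z_def split: if_splits)
  qed
  have z01: "z i g \<in> {0, 1}" for i g by (simp add: z_def)
  have zsum: "(\<Sum>i\<in>A. f i * z i g) = (\<Sum>i\<in>A \<inter> C g. f i)" if "finite A" for A f g
  proof -
    have "{i \<in> A. z i g = 1} = A \<inter> C g" by (auto simp: z_def)
    then show ?thesis using sum_mult_01[of A "\<lambda>i. z i g" f] z01 that by simp
  qed
  have zcard: "(\<Sum>i\<in>A. z i g) = real (card (A \<inter> C g))" if "finite A" for A g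
    using zsum[OF that, of "\<lambda>_. 1"] by simp
  have avsum: "(\<Sum>i\<in>avail \<Gamma> j. f i * z i g) = (\<Sum>i\<in>coal_avail \<Gamma> (C g) j. f i)"
    if "j \<in> items \<Gamma>" for f g j
    using zsum[OF wf_game_finite_avail[OF wf that]] by (simp add: coal_avail_def)
  have ycap: "y g j \<le> (\<Sum>i\<in>avail \<Gamma> j. cap \<Gamma> i j * z i g)" if "j \<in> items \<Gamma>" for g j
    unfolding y_def by (rule sum_mono) (use Xbox that in blast)

  have one: "(\<Sum>g\<in>players \<Gamma>. z i g) = 1" if i: "i \<in> players \<Gamma>" for i
  proof -
    obtain g where g: "g \<in> players \<Gamma>" "\<And>h. i \<in> C h \<longleftrightarrow> h = g" using C_ex1[OF i] by blast
    then have "(\<Sum>h\<in>players \<Gamma>. z i h) = (\<Sum>h\<in>players \<Gamma>. if h = g then 1 else 0)"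
      by (intro sum.cong refl) (auto simp: z_def)
    then show ?thesis using g(1) by simp
  qed
  have payoff: "\<pi> g = (\<Sum>i\<in>players \<Gamma>. v i * z i g)" for g
    using zsum[of "players \<Gamma>" v g] C_sub[of g] CV XV by (simp add: \<pi>_def Int_absorb1)
  have bounds: "v i * z i g \<le> v i \<and> v i * z i g \<le> bigM \<Gamma> * z i g \<and>
      v i * z i g \<ge> v i - bigM \<Gamma> * (1 - z i g) \<and> v i * z i g \<ge> 0" if "i \<in> players \<Gamma>" for i g
    using v0[OF that] vM[OF that] by (simp add: z_def)
  have budget: "(\<Sum>j\<in>items \<Gamma>. weight \<Gamma> j * y g j) \<le> (\<Sum>i\<in>players \<Gamma>. budget \<Gamma> i * z i g)" for g
    using X[of g] zsum[of "players \<Gamma>" "budget \<Gamma>" g] C_sub[of g]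
    by (simp add: group_plan_def y_def x_def Int_absorb1)
  have privc: "private_lhs \<Gamma> i k (x i g) \<le> private_rhs \<Gamma> i k * z i g"
    if "i \<in> players \<Gamma>" "k < num_private \<Gamma> i" for i g k
  proof (cases "i \<in> C g")
    case True
    then have "private_ok \<Gamma> i (X g i)" using X[of g] by (simp add: group_plan_def)
    then show ?thesis using True that by (simp add: private_ok_def z_def x_def private_lhs_def)
  next
    case False
    \<comment> \<open>For a nonmember the plan slice vanishes and the row reads
      \<open>0 \<le> 0\<close>.\<close>
    then have "private_lhs \<Gamma> i k (x i g) = 0"
      using group_plan_zero[OF X] by (simp add: private_lhs_def items_of_def x_def)
    then show ?thesis using False by (simp add: z_def)
  qed
  have zlt: "z i g = 0" if "i < g" for i g
    using that C_le[of i g] by (auto simp: z_def)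
  \<comment> \<open>A nonempty \<open>C g\<close> contains its label, so
    \<open>z g g = 1\<close>.\<close>
  have rep: "(\<Sum>i\<in>players \<Gamma>. z i g) \<le> real (card (players \<Gamma>)) * z g g" for g
  proof (cases "C g = {}")
    case True
    then show ?thesis by (simp add: z_def)
  next
    case False
    have "card (players \<Gamma> \<inter> C g) \<le> card (players \<Gamma>)" by (intro card_mono) auto
    then show ?thesis using C_rep[OF False] zcard[of "players \<Gamma>" g] by (simp add: z_def)
  qed
  have \<pi>0: "0 \<le> \<pi> g" for g
    unfolding payoff by (rule sum_nonneg) (use bounds in blast)
  have ynat: "y g j \<in> \<nat>" if "j \<in> items \<Gamma>" for g j
    using X[of g] that by (simp add: group_plan_def y_def x_def)
  have pool: "\<exists>w. pooling_constraints \<Gamma> K y z w" if p: "pooling \<Gamma> < 1"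
  proof -
    \<comment> \<open>\<open>w\<close> flags items shared by at least two members. For
      \<open>n\<close> available members the counting constraints become
      \<open>2 \<le> n \<le> card (avail \<Gamma> j)\<close> if flagged and
      \<open>0 \<le> n \<le> 1\<close> otherwise.\<close>
    define w :: "nat \<Rightarrow> 'r \<Rightarrow> real" where "w g j = of_bool (2 \<le> card (coal_avail \<Gamma> (C g) j))" for g j
    have "w g j \<in> {0, 1} \<and> 2 * w g j \<le> (\<Sum>i\<in>avail \<Gamma> j. z i g) \<and>
        (\<Sum>i\<in>avail \<Gamma> j. z i g) \<le> (real (card (avail \<Gamma> j)) - 1) * w g j + 1 \<and>
        y g j \<le> pooling \<Gamma> * (\<Sum>i\<in>avail \<Gamma> j. cap \<Gamma> i j * z i g) + K j * (1 - w g j)"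
      if j: "j \<in> items \<Gamma>" for g j
    proof -
      have fa: "finite (avail \<Gamma> j)" by (rule wf_game_finite_avail[OF wf j])
      have zc: "(\<Sum>i\<in>avail \<Gamma> j. z i g) = real (card (coal_avail \<Gamma> (C g) j))"
        using zcard[OF fa] by (simp add: coal_avail_def)
      have le: "card (coal_avail \<Gamma> (C g) j) \<le> card (avail \<Gamma> j)"
        unfolding coal_avail_def using fa by (intro card_mono) auto
      show ?thesis
      proof (cases "2 \<le> card (coal_avail \<Gamma> (C g) j)")
        case True
        then have "y g j \<le> pooling \<Gamma> * (\<Sum>i\<in>coal_avail \<Gamma> (C g) j. cap \<Gamma> i j)"
          using X[of g] j by (simp add: group_plan_def y_def x_def)
        then show ?thesis using True le zc avsum[OF j] by (simp add: w_def)
      next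
        case False
        have "y g j \<le> pooling \<Gamma> * (\<Sum>i\<in>coal_avail \<Gamma> (C g) j. cap \<Gamma> i j) + K j"
          using card_le_1_pooling[OF wf j, of K "C g"] K[OF p] j False ycap[OF j, of g] avsum[OF j]
          by auto
        then show ?thesis using False zc avsum[OF j] by (simp add: w_def)
      qed
    qed
    then show ?thesis unfolding pooling_constraints_def by blast
  qed
  have prof: "\<pi> g = (\<Sum>j\<in>items \<Gamma>. \<Sum>i\<in>avail \<Gamma> j. profit \<Gamma> i j * x i g j)" for g
    by (simp add: \<pi>_def plan_profit_def x_def)
  have "(v, x, y, z, \<pi>) \<in> formulation \<Gamma> K"
    unfolding formulation_def mem_Collect_eq case_prod_conv
    \<comment> \<open>The auxiliary \<open>\<phi>\<close> is the product that it linearizes; each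
      remaining conjunct matches one of the facts above.\<close>
    by (intro conjI exI[of _ "\<lambda>i g. v i * z i g"]; (intro ballI allI impI)?;
        (rule ext one prof payoff bounds budget y_def privc Xbox ycap zlt rep v0 \<pi>0 ynat z01 pool;
         assumption))
  moreover have "coal_value \<Gamma> s - M s * (real (card s) - (\<Sum>i\<in>s. z i g)) \<le> (\<Sum>i\<in>s. v i)"
    if s: "s \<subseteq> players \<Gamma>" for s g
  proof -
    have fs: "finite s" using s finite_players finite_subset by blast
    show ?thesis
    proof (cases "s \<subseteq> C g")
      case True
      then show ?thesis using C_stable[OF True] zcard[OF fs, of g] by (simp add: Int_absorb2)
    next
      case False
      \<comment> \<open>Some player of \<open>s\<close> lies outside the group, so the deficit is an
        integer of size at least 1 and one copy of \<open>M s\<close> already cancels the value of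
        \<open>s\<close>.\<close>
      then have "card (s \<inter> C g) < card s" using fs by (intro psubset_card_mono) auto
      then have "1 \<le> real (card s) - (\<Sum>i\<in>s. z i g)" using zcard[OF fs, of g] by simp
      moreover have "coal_value \<Gamma> s \<le> M s" "0 \<le> M s" using M s by auto
      ultimately have "coal_value \<Gamma> s \<le> M s * (real (card s) - (\<Sum>i\<in>s. z i g))"
        by (metis mult.right_neutral mult_left_mono order_trans)
      moreover have "0 \<le> sum v s" using v0 s by (intro sum_nonneg) auto
      ultimately show ?thesis by simp
    qed
  qed
  ultimately show ?thesis
    unfolding stab_formulation_def by blast
qed

section \<open>Maximizing the total payoff\<close>

text \<open>The objective reads only \<open>v\<close>, so competitors may be compared through their
  projections. Together with \<open>oscs_iff\<close> this lets the equality of the two payoff sets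
  carry optimality across.\<close>

lemma payoff_sum_maximizer_iff:
  "payoff_sum_maximizer \<Gamma> P (v, x, y, z, \<pi>) \<longleftrightarrow>
    (v, x, y, z, \<pi>) \<in> P \<and> (\<forall>v'\<in>proj_v P. sum v' (players \<Gamma>) \<le> sum v (players \<Gamma>))"
  unfolding payoff_sum_maximizer_def is_arg_max_def proj_v_def by (simp add: not_less) blast

lemma oscs_iff:
  "oscs \<Gamma> CS v \<longleftrightarrow>
    scs \<Gamma> CS v \<and> (\<forall>v'\<in>stable_payoffs \<Gamma>. sum v' (players \<Gamma>) \<le> sum v (players \<Gamma>))"
  by (auto simp: oscs_def is_arg_max_def stable_payoffs_def not_less)

text \<open>There may be infinitely many stable payoffs, but by \<open>scs_sum_payoffs\<close> their
  totals are determined by the partition, and a finite set has finitely many partitions. The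
  singleton structure shows that some total exists.\<close>

lemma ex_max_stable_payoff:
  "\<exists>v\<in>stable_payoffs \<Gamma>. \<forall>v'\<in>stable_payoffs \<Gamma>. sum v' (players \<Gamma>) \<le> sum v (players \<Gamma>)"
proof -
  let ?T = "(\<lambda>v. sum v (players \<Gamma>)) ` stable_payoffs \<Gamma>"
  have "?T \<subseteq> (\<lambda>CS. \<Sum>c\<in>CS. coal_value \<Gamma> c) ` {CS. partition_on (players \<Gamma>) CS}"
  proof
    fix r assume "r \<in> ?T"
    then obtain CS v where v: "scs \<Gamma> CS v" "r = sum v (players \<Gamma>)"
      by (auto simp: stable_payoffs_def)
    then have "r = (\<Sum>c\<in>CS. coal_value \<Gamma> c)" "partition_on (players \<Gamma>) CS"
      using scs_sum_payoffs[OF v(1)] by (simp_all add: scs_iff)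
    then show "r \<in> (\<lambda>CS. \<Sum>c\<in>CS. coal_value \<Gamma> c) ` {CS. partition_on (players \<Gamma>) CS}"
      by simp
  qed
  then have fin: "finite ?T"
    by (rule finite_subset) (simp add: finitely_many_partition_on)
  have "?T \<noteq> {}"
    using ex_scs[of \<Gamma>] by (auto simp: stable_payoffs_def)
  then have "Max ?T \<in> ?T"
    by (rule Max_in[OF fin])
  then obtain v where v: "v \<in> stable_payoffs \<Gamma>" "Max ?T = sum v (players \<Gamma>)"
    by blast
  have "sum v' (players \<Gamma>) \<le> sum v (players \<Gamma>)" if "v' \<in> stable_payoffs \<Gamma>" for v'
    unfolding v(2)[symmetric] by (rule Max_ge[OF fin imageI[OF that]])
  then show ?thesis using v(1) by blast
qed

theorem theorem1:
  fixes \<Gamma> :: "'r game" and K :: "'r \<Rightarrow> real" and M :: "nat set \<Rightarrow> real"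
  assumes "wf_game \<Gamma>"
    and "pooling \<Gamma> < 1 \<Longrightarrow> \<forall>j\<in>items \<Gamma>. K j \<ge> (1 - pooling \<Gamma>) * max_cap \<Gamma> j"
    and "\<forall>s\<subseteq>players \<Gamma>. M s \<ge> max (coal_value \<Gamma> s) 0"
    and "\<forall>i\<in>players \<Gamma>. coal_value \<Gamma> {i} \<ge> 0"
  shows "proj_v (stab_formulation \<Gamma> K M) = stable_payoffs \<Gamma> \<and>
    (\<exists>q. payoff_sum_maximizer \<Gamma> (stab_formulation \<Gamma> K M) q) \<and>
    (\<forall>v x y z \<pi>. payoff_sum_maximizer \<Gamma> (stab_formulation \<Gamma> K M) (v, x, y, z, \<pi>) \<longrightarrow>
       oscs \<Gamma> (coalitions_of \<Gamma> z) v)"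
proof -
  let ?P = "stab_formulation \<Gamma> K M"
  have "v \<in> proj_v ?P \<longleftrightarrow> v \<in> stable_payoffs \<Gamma>" for v
  proof
    assume "v \<in> proj_v ?P"
    then obtain x y z \<pi> where "(v, x, y, z, \<pi>) \<in> ?P"
      by (auto simp: proj_v_def)
    from stab_formulation_scs[OF assms(1) this] show "v \<in> stable_payoffs \<Gamma>"
      by (auto simp: stable_payoffs_def)
  next
    assume "v \<in> stable_payoffs \<Gamma>"
    then obtain CS where "scs \<Gamma> CS v"
      by (auto simp: stable_payoffs_def)
    from scs_stab_formulation[OF assms this] show "v \<in> proj_v ?P"
      by (simp add: proj_v_def)
  qed
  then have proj: "proj_v ?P = stable_payoffs \<Gamma>" by blast
  from ex_max_stable_payoff[of \<Gamma>] obtain v where v: "v \<in> proj_v ?P"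
    and max: "\<forall>v'\<in>proj_v ?P. sum v' (players \<Gamma>) \<le> sum v (players \<Gamma>)"
    unfolding proj by blast
  from v obtain x y z \<pi> where "(v, x, y, z, \<pi>) \<in> ?P"
    by (auto simp: proj_v_def)
  then have "payoff_sum_maximizer \<Gamma> ?P (v, x, y, z, \<pi>)"
    using max by (simp only: payoff_sum_maximizer_iff simp_thms)
  \<comment> \<open>The structure encoded by the maximizer's own \<open>z\<close> is stable, and its
    payoff dominates every stable payoff because these are the projected ones.\<close>
  moreover have "oscs \<Gamma> (coalitions_of \<Gamma> z) v"
    if "payoff_sum_maximizer \<Gamma> ?P (v, x, y, z, \<pi>)" for v x y z \<pi>
    using that unfolding payoff_sum_maximizer_iff oscs_iff proj
    by (blast intro: stab_formulation_scs[OF assms(1)])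
  ultimately show ?thesis using proj by blast
qed

end
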